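(* Let $a,b,c,k,l,m$ be positive integers with $c\mid ab$ and $k,l\ge m$, let $h=\frac{a^kb^l}{c^m}$ (a positive integer), and let $d_i^{\pm}=a^{2k}b^{2l}\pm i c^m$ for $i=1,2$, where each $d_i^\pm$ under consideration is a square-free positive integer. Then: (i) $\sqrt{d_1^-}=[a^kb^l-1;\overline{1,2h-2,1,2a^kb^l-2}]$ when $ab\ge 2$; (ii) $\sqrt{d_1^+}=[a^kb^l;\overline{2h,2a^kb^l}]$; (iii) $\sqrt{d_2^-}=[a^kb^l-1;\overline{1,h-2,1,2a^kb^l-2}]$ when $ab\ge 3$; (iv) $\sqrt{d_2^+}=[a^kb^l;\overline{h,2a^kb^l}]$.
   Context: $[a_0;\overline{a_1,\dots,a_n}]$ denotes the continued fraction $a_0+\cfrac{1}{a_1+\cfrac{1}{a_2+\cdots}}$ whose sequence of partial quotients after $a_0$ is the block $a_1,\dots,a_n$ repeated indefinitely. *)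

theory Defs
  imports Complex_Main "HOL-Computational_Algebra.Squarefree"
begin

primrec cfrac_convergent :: "nat \<Rightarrow> (nat \<Rightarrow> int) \<Rightarrow> real" where
  "cfrac_convergent 0 q = of_int (q 0)"
| "cfrac_convergent (Suc n) q = of_int (q 0) + 1 / cfrac_convergent n (\<lambda>i. q (Suc i))"

text \<open>Partial quotients are arbitrary integers: some expansions of interest have degenerate
  quotients 0 or -1. A vanishing intermediate denominator falls under the convention
  \<^prop>\<open>1 / (0::real) = 0\<close>.\<close>

definition has_cfrac :: "real \<Rightarrow> (nat \<Rightarrow> int) \<Rightarrow> bool" where
  "has_cfrac x q \<longleftrightarrow> (\<lambda>n. cfrac_convergent n q) \<longlonglongrightarrow> x"

definition periodic_quotients :: "int \<Rightarrow> int list \<Rightarrow> nat \<Rightarrow> int" where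
  "periodic_quotients a0 as n = (case n of 0 \<Rightarrow> a0 | Suc i \<Rightarrow> as ! (i mod length as))"

lemma power_dvd_power_mult_power:
  fixes a b c :: int
  assumes "c dvd a * b" "k \<ge> m" "l \<ge> m"
  shows "c ^ m dvd a ^ k * b ^ l"
proof -
  have "c ^ m dvd a ^ m * b ^ m"
    using assms(1) by (metis dvd_power_same power_mult_distrib)
  also have "a ^ m * b ^ m dvd a ^ k * b ^ l"
    using assms(2,3) by (intro mult_dvd_mono le_imp_power_dvd)
  finally show ?thesis .
qed

end

theory Submission
  imports Defs
begin

text \<open>
  Put \<open>N = a\<^sup>k b\<^sup>l\<close> and let \<open>H\<close> be \<open>2 h\<close> or \<open>h\<close>, so that the radicands are \<open>N\<^sup>2 \<mp> 2 N / H\<close>.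
  Replacing the integer part by the last quotient of the period makes the expansion purely periodic,
  and its convergents \<open>x\<^sub>n\<close> satisfy \<open>x\<^sub>n\<^sub>+\<^sub>p = T x\<^sub>n\<close> for a Moebius map \<open>T\<close>. For the plus sign
  \<open>T x = 2 N + 1 / (H + 1 / x)\<close>; for the minus sign \<open>u = x + 1\<close> moves by
  \<open>u \<mapsto> 2 N - 1 / (H - 1 / u)\<close>. Both maps contract towards \<open>N + \<surd>(N\<^sup>2 \<plusminus> 2 N / H)\<close>
  on a half-line containing the first \<open>p\<close> convergents. In the variable \<open>u\<close> this remains true
  when the quotient \<open>H - 2\<close> degenerates to \<open>0\<close> or \<open>-1\<close>.
\<close>

text \<open>Along each residue class mod \<open>p\<close> the error decays geometrically. The sum
  \<open>K\<close> dominates the errors of all \<open>p\<close> starting values, so a single bound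
  \<open>r ^ (n div p) * K\<close> serves every class.\<close>

lemma tendsto_if_periodic_contraction:
  fixes f :: "nat \<Rightarrow> real"
  assumes p: "p > 0" and r: "0 \<le> r" "r < 1"
    and step: "\<And>n. \<bar>f (n + p) - L\<bar> \<le> r * \<bar>f n - L\<bar>"
  shows "f \<longlonglongrightarrow> L"
proof -
  define K where "K = (\<Sum>i<p. \<bar>f i - L\<bar>)"
  have iter: "\<bar>f (i + j * p) - L\<bar> \<le> r ^ j * \<bar>f i - L\<bar>" for i j
  proof (induction j)
    case (Suc j)
    have "\<bar>f (i + Suc j * p) - L\<bar> \<le> r * \<bar>f (i + j * p) - L\<bar>"
      using step[of "i + j * p"] by (simp add: algebra_simps)
    also have "\<dots> \<le> r * (r ^ j * \<bar>f i - L\<bar>)"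
      using Suc r by (intro mult_left_mono) auto
    finally show ?case by (simp add: mult.assoc)
  qed simp
  have bound: "norm (f n - L) \<le> r ^ (n div p) * K" for n
  proof -
    have "\<bar>f n - L\<bar> \<le> r ^ (n div p) * \<bar>f (n mod p) - L\<bar>"
      using iter[of "n mod p" "n div p"] by simp
    also have "\<bar>f (n mod p) - L\<bar> \<le> K"
      unfolding K_def using p by (intro member_le_sum) auto
    finally show ?thesis using r by (simp add: mult_left_mono)
  qed
  have "filterlim (\<lambda>n. n div p) at_top sequentially"
    unfolding filterlim_at_top
  proof
    fix Z
    show "\<forall>\<^sub>F n in sequentially. Z \<le> n div p"
      using eventually_ge_at_top[of "Z * p"]
      by eventually_elim (use p in \<open>simp add: less_eq_div_iff_mult_less_eq\<close>)
  qed
  then have "(\<lambda>n. r ^ (n div p)) \<longlonglongrightarrow> 0"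
    using LIMSEQ_realpow_zero[OF r] by (rule filterlim_compose[rotated])
  then have "(\<lambda>n. f n - L) \<longlonglongrightarrow> 0"
    by (rule tendsto_0_le[where K = K]) (use bound r in auto)
  then show ?thesis by (simp add: LIM_zero_iff)
qed

text \<open>Only index 0 is delicate: the head is compared with index \<open>length as\<close>,
  where the last entry of the block stands.\<close>

lemma periodic_quotients_last_periodic:
  assumes "as \<noteq> []"
  shows "periodic_quotients (last as) as (i + length as) = periodic_quotients (last as) as i"
proof (cases i)
  case 0
  obtain j where j: "length as = Suc j" using assms by (cases as) auto
  then show ?thesis using 0 assms by (simp add: periodic_quotients_def last_conv_nth)
qed (simp add: periodic_quotients_def)

lemma cfrac_convergent_change_head:
  "cfrac_convergent n (periodic_quotients x as) =
     cfrac_convergent n (periodic_quotients y as) + of_int (x - y)"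
  by (cases n) (simp_all add: periodic_quotients_def)

text \<open>The head enters every convergent additively. This leads from the purely periodic
  expansion back to the one with the required integer part.\<close>

lemma has_cfrac_periodic_quotients_shift:
  assumes "has_cfrac (z + of_int (y - x)) (periodic_quotients y as)"
  shows "has_cfrac z (periodic_quotients x as)"
proof -
  have "(\<lambda>n. cfrac_convergent n (periodic_quotients y as) + of_int (x - y))
          \<longlonglongrightarrow> z + of_int (y - x) + of_int (x - y)"
    using assms unfolding has_cfrac_def by (intro tendsto_add) auto
  then show ?thesis
    by (simp add: has_cfrac_def cfrac_convergent_change_head[of _ x as y])
qed

text \<open>A difference of two Moebius values is the determinant times the difference of the
  arguments over the product of the denominators. Here \<open>e = 1\<close> serves the plus sign and
  \<open>e = -1\<close> the minus sign; a large product means contraction.\<close>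

lemma inverse_shift_diff:
  fixes x y H :: real
  assumes "x > 0" "y > 0" "H * x + e \<noteq> 0" "H * y + e \<noteq> 0"
  shows "1 / (H + e / x) - 1 / (H + e / y) = e * (x - y) / ((H * x + e) * (H * y + e))"
proof -
  have "1 / (H + e / x) = x / (H * x + e)" "1 / (H + e / y) = y / (H * y + e)"
    using assms by (auto simp: field_simps)
  then show ?thesis using assms by (simp add: field_simps)
qed

lemma has_cfrac_sqrt_plus:
  fixes N H :: int
  assumes N: "N \<ge> 1" and H: "H \<ge> 1"
  shows "has_cfrac (sqrt (of_int N ^ 2 + 2 * of_int N / of_int H)) (periodic_quotients N [H, 2 * N])"
proof -
  define s where "s = periodic_quotients (2 * N) [H, 2 * N]"
  define f where "f = (\<lambda>n. cfrac_convergent n s)"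
  define nr hr :: real where "nr = of_int N" and "hr = of_int H"
  define \<xi> where "\<xi> = nr + sqrt (nr ^ 2 + 2 * nr / hr)"
  have nr: "nr \<ge> 1" and hr: "hr \<ge> 1" using N H by (auto simp: nr_def hr_def)
  have s: "s 0 = 2 * N" "s (Suc 0) = H" by (simp_all add: s_def periodic_quotients_def)
  have "s (i + 2) = s i" for i
    using periodic_quotients_last_periodic[of "[H, 2 * N]" i] by (simp add: s_def)
  then have f_step: "f (n + 2) = 2 * nr + 1 / (hr + 1 / f n)" for n
    by (simp add: f_def s nr_def hr_def)
  have f_ge: "f n \<ge> 1" for n
  proof (induction n rule: induct_nat_012)
    case (ge2 n)
    have "1 / (hr + 1 / f n) \<ge> 0" using hr ge2 by simp
    then show ?case using f_step[of n] nr by (simp del: zero_le_divide_1_iff)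
  qed (use nr hr in \<open>simp_all add: f_def s flip: nr_def hr_def, smt (verit) divide_nonneg_nonneg\<close>)
  have \<xi>_ge: "\<xi> \<ge> 1"
    using nr hr by (simp add: \<xi>_def add_increasing2)
  \<comment> \<open>This is the fixed-point equation with denominators cleared; squaring
    \<open>\<xi> - nr\<close> removes the root.\<close>
  have quad: "hr * \<xi>^2 = 2 * nr * hr * \<xi> + 2 * nr"
  proof -
    have "(\<xi> - nr)^2 = nr ^ 2 + 2 * nr / hr"
      using nr hr by (simp add: \<xi>_def)
    then have "hr * (\<xi> - nr)^2 = hr * nr ^ 2 + 2 * nr"
      using hr by (simp add: field_simps)
    then show ?thesis by (simp add: power2_eq_square algebra_simps)
  qed
  have fix_pt: "\<xi> = 2 * nr + 1 / (hr + 1 / \<xi>)"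
  proof -
    have pos: "hr * \<xi> + 1 > 0" using hr \<xi>_ge by (simp add: add_pos_pos)
    have "1 / (hr + 1 / \<xi>) = \<xi> / (hr * \<xi> + 1)" using \<xi>_ge by (simp add: field_simps)
    moreover have "\<xi> = 2 * nr + \<xi> / (hr * \<xi> + 1)"
      using quad pos by (simp add: field_simps power2_eq_square)
    ultimately show ?thesis by linarith
  qed
  have "f \<longlonglongrightarrow> \<xi>"
  \<comment> \<open>Since \<open>hr\<close>, \<open>f n\<close> and \<open>\<xi>\<close> are at
    least 1, both denominators are at least 2, whence the factor 1/4.\<close>
  proof (rule tendsto_if_periodic_contraction[where p = 2 and r = "1/4"])
    fix n
    define P where "P = (hr * f n + 1) * (hr * \<xi> + 1)"
    have "1 * 1 \<le> hr * f n" "1 * 1 \<le> hr * \<xi>"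
      using hr f_ge[of n] \<xi>_ge by (intro mult_mono; simp)+
    then have ge: "hr * f n + 1 \<ge> 2" "hr * \<xi> + 1 \<ge> 2" by auto
    then have "P \<ge> 2 * 2" unfolding P_def by (intro mult_mono) auto
    have "f (n + 2) - \<xi> = 1 / (hr + 1 / f n) - 1 / (hr + 1 / \<xi>)"
      using f_step[of n] fix_pt by linarith
    also have "\<dots> = (f n - \<xi>) / P"
      using ge f_ge[of n] \<xi>_ge by (subst inverse_shift_diff) (auto simp: P_def)
    finally show "\<bar>f (n + 2) - \<xi>\<bar> \<le> 1 / 4 * \<bar>f n - \<xi>\<bar>"
      using \<open>P \<ge> 2 * 2\<close> by (simp add: pos_divide_le_eq mult_left_mono)
  qed simp_all
  then show ?thesis
    by (intro has_cfrac_periodic_quotients_shift[of _ "2 * N" N])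
      (simp add: has_cfrac_def f_def s_def \<xi>_def nr_def hr_def add.commute)
qed

text \<open>The hypothesis \<open>H * N \<ge> 3\<close> excludes \<open>N = 2, H = 1\<close>, where the map is parabolic
  (its fixed point \<open>u = 2\<close> has multiplier 1).\<close>

lemma has_cfrac_sqrt_minus:
  fixes N H :: int
  assumes N: "N \<ge> 2" and H: "H \<ge> 1" and HN: "H * N \<ge> 3"
    and nonneg: "of_int N ^ 2 - 2 * of_int N / of_int H \<ge> (0 :: real)"
  shows "has_cfrac (sqrt (of_int N ^ 2 - 2 * of_int N / of_int H))
           (periodic_quotients (N - 1) [1, H - 2, 1, 2 * N - 2])"
proof -
  define s where "s = periodic_quotients (2 * N - 2) [1, H - 2, 1, 2 * N - 2]"
  define u where "u = (\<lambda>n. cfrac_convergent n s + 1)"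
  define nr hr :: real where "nr = of_int N" and "hr = of_int H"
  define \<xi> where "\<xi> = nr + sqrt (nr ^ 2 - 2 * nr / hr)"
  have nr: "nr \<ge> 2" and hr: "hr \<ge> 1" using N H by (auto simp: nr_def hr_def)
  have s: "s 0 = 2 * N - 2" "s (Suc 0) = 1" "s (Suc (Suc 0)) = H - 2" "s (Suc (Suc (Suc 0))) = 1"
    by (simp_all add: s_def periodic_quotients_def)
  have s_periodic: "s (Suc (Suc (Suc (Suc i)))) = s i" for i
    using periodic_quotients_last_periodic[of "[1, H - 2, 1, 2 * N - 2]" i] by (simp add: s_def)
  have Suc4: "n + 4 = Suc (Suc (Suc (Suc n)))" for n by simp
  \<comment> \<open>The identity \<open>1 / (1 + 1 / (y - 1)) = 1 - 1 / y\<close>, used at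
    \<open>y = x + 1\<close> and then at \<open>y = w\<close>, absorbs both quotients 1 into minus
    signs.\<close>
  have moebius: "2 * nr - 2 + 1 / (1 + 1 / (hr - 2 + 1 / (1 + 1 / x))) + 1 = 2 * nr - 1 / (hr - 1 / (x + 1))"
    if "x \<ge> 1" for x
  proof -
    define t where "t = x + 1"
    define w where "w = hr - 1 / t"
    have t: "t \<ge> 2" using that by (simp add: t_def)
    have "1 / t \<le> 1 / 2" using t by (simp add: field_simps)
    then have w: "w > 0" using hr by (simp add: w_def)
    \<comment> \<open>At \<open>w = 1\<close> the convention for division by 0 would break the
      identity: its left side would be 1, its right side 0. Integrality of \<open>H\<close> rules
      this out.\<close>
    have w1: "w \<noteq> 1"
    proof
      assume "w = 1"
      then have "hr = 1 + 1 / t" by (simp add: w_def)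
      moreover have "0 < 1 / t" "1 / t < 1" using t by auto
      ultimately have "1 < hr" "hr < 2" by auto
      then show False by (simp add: hr_def)
    qed
    have "1 / (1 + 1 / x) = 1 - 1 / t" using that by (simp add: t_def field_simps)
    then have "hr - 2 + 1 / (1 + 1 / x) = w - 1" by (simp add: w_def)
    moreover have "1 / (1 + 1 / (w - 1)) = 1 - 1 / w" using w w1 by (simp add: field_simps)
    ultimately show ?thesis by (simp add: w_def t_def)
  qed
  have u_step: "u (n + 4) = 2 * nr - 1 / (hr - 1 / u n)" if "u n \<ge> 2" for n
    using moebius[of "u n - 1"] that unfolding Suc4
    by (simp add: u_def s s_periodic nr_def hr_def)
  have u_start: "u n \<ge> 2 * nr - 2" if n4: "n < 4" for n
  proof -
    consider "n = 0" | "n = 1" | "n = 2" | "n = 3"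
      using n4 by (auto simp: less_Suc_eq numeral_eq_Suc)
    then show ?thesis
    proof cases
      case 3
      have "1 / (1 + 1 / (hr - 2)) \<ge> 0"
      \<comment> \<open>For \<open>H = 1\<close> the denominator \<open>1 + 1 / (hr - 2)\<close>
        vanishes and the quotient is 0 by convention.\<close>
      proof (cases "H = 1")
        case False
        then have "hr \<ge> 2" using H by (simp add: hr_def)
        then show ?thesis by simp
      qed (simp add: hr_def)
      then show ?thesis using 3 by (simp add: u_def s numeral_2_eq_2 nr_def hr_def)
    next
      case 4
      have "1 / (1 + 1 / (hr - 1)) \<ge> 0" using hr by simp
      then show ?thesis using 4 by (simp add: u_def s numeral_3_eq_3 nr_def hr_def)
    qed (use nr in \<open>simp_all add: u_def s nr_def\<close>)
  qed
  \<comment> \<open>The bound reproduces itself: as \<open>nr \<ge> 2\<close> it gives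
    \<open>u j \<ge> 2\<close>, so \<open>hr - 1 / u j\<close> is at least 1/2 and at most 2 is
    subtracted from \<open>2 * nr\<close>.\<close>
  have u_ge: "u n \<ge> 2 * nr - 2" for n
  proof (induction n rule: less_induct)
    case (less n)
    show ?case
    proof (cases "n < 4")
      case False
      then obtain j where j: "n = j + 4" by (metis add.commute le_Suc_ex not_less)
      then have uj: "u j \<ge> 2" using less[of j] nr by simp
      then have "1 / u j \<le> 1 / 2" by (simp add: field_simps)
      then have "1 / (hr - 1 / u j) \<le> 1 / (1 / 2)" using hr by (intro divide_left_mono) auto
      then show ?thesis using u_step[OF uj] j by simp
    qed (rule u_start)
  qed
  have hn: "hr * nr \<ge> 3"
    using HN unfolding nr_def hr_def by (metis of_int_le_iff of_int_mult of_int_numeral)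
  have \<xi>_ge: "\<xi> \<ge> nr" using nonneg by (simp add: \<xi>_def nr_def hr_def)
  have h\<xi>: "hr * \<xi> \<ge> 3" using hn \<xi>_ge hr by (smt (verit) mult_left_mono)
  have quad: "hr * \<xi>^2 = 2 * nr * hr * \<xi> - 2 * nr"
  proof -
    have "(\<xi> - nr)^2 = nr ^ 2 - 2 * nr / hr"
      using nonneg by (simp add: \<xi>_def nr_def hr_def)
    then have "hr * (\<xi> - nr)^2 = hr * nr ^ 2 - 2 * nr"
      using hr by (simp add: field_simps)
    then show ?thesis by (simp add: power2_eq_square algebra_simps)
  qed
  have fix_pt: "\<xi> = 2 * nr - 1 / (hr - 1 / \<xi>)"
  proof -
    have pos: "hr * \<xi> - 1 > 0" using h\<xi> by simp
    have "1 / (hr - 1 / \<xi>) = \<xi> / (hr * \<xi> - 1)" using \<xi>_ge nr by (simp add: field_simps)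
    moreover have "\<xi> = 2 * nr - \<xi> / (hr * \<xi> - 1)"
      using quad pos by (simp add: field_simps power2_eq_square)
    ultimately show ?thesis by linarith
  qed
  have "u \<longlonglongrightarrow> \<xi>"
  \<comment> \<open>The denominator at \<open>u n\<close> is only bounded below by 1; the factor 1/2
    comes from the one at \<open>\<xi>\<close>, which is at least 2 by \<open>HN\<close>.\<close>
  proof (rule tendsto_if_periodic_contraction[where p = 4 and r = "1/2"])
    fix n
    define P where "P = (hr * u n - 1) * (hr * \<xi> - 1)"
    have un: "u n \<ge> 2" using u_ge[of n] nr by simp
    have "1 * 2 \<le> hr * u n" using un hr by (intro mult_mono) auto
    then have ge: "hr * u n - 1 \<ge> 1" "hr * \<xi> - 1 \<ge> 2" using h\<xi> by auto
    then have "P \<ge> 1 * 2" unfolding P_def by (intro mult_mono) auto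
    have "u (n + 4) - \<xi> = - (1 / (hr + (- 1) / u n) - 1 / (hr + (- 1) / \<xi>))"
      using u_step[OF un] fix_pt unfolding minus_divide_left[symmetric] add_uminus_conv_diff by linarith
    also have "\<dots> = (u n - \<xi>) / P"
      using ge un \<xi>_ge nr by (subst inverse_shift_diff) (auto simp: P_def diff_divide_distrib)
    finally show "\<bar>u (n + 4) - \<xi>\<bar> \<le> 1 / 2 * \<bar>u n - \<xi>\<bar>"
      using \<open>P \<ge> 1 * 2\<close> by (simp add: pos_divide_le_eq mult_left_mono)
  qed simp_all
  \<comment> \<open>Undoing the shift by 1 leaves the root plus \<open>N - 1\<close>, which is
    exactly the change of head from \<open>N - 1\<close> to \<open>2 * N - 2\<close>.\<close>
  then have "(\<lambda>n. u n - 1) \<longlonglongrightarrow> \<xi> - 1" by (intro tendsto_intros)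
  then show ?thesis
    by (intro has_cfrac_periodic_quotients_shift[of _ "2 * N - 2" "N - 1"])
      (simp add: has_cfrac_def u_def s_def \<xi>_def nr_def hr_def algebra_simps)
qed

theorem theorem4p1:
  fixes a b c h :: int and k l m :: nat and d_minus d_plus :: "int \<Rightarrow> int"
  assumes "a > 0" "b > 0" "c > 0" "k > 0" "l > 0" "m > 0"
    and "c dvd a * b" and "k \<ge> m" and "l \<ge> m"
    and "h = (a ^ k * b ^ l) div c ^ m"
    and "d_minus = (\<lambda>i. a ^ (2 * k) * b ^ (2 * l) - i * c ^ m)"
    and "d_plus = (\<lambda>i. a ^ (2 * k) * b ^ (2 * l) + i * c ^ m)"
  shows "(d_minus 1 > 0 \<and> squarefree (d_minus 1) \<and> a * b \<ge> 2 \<longrightarrow>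
            has_cfrac (sqrt (of_int (d_minus 1)))
              (periodic_quotients (a ^ k * b ^ l - 1) [1, 2 * h - 2, 1, 2 * a ^ k * b ^ l - 2])) \<and>
         (d_plus 1 > 0 \<and> squarefree (d_plus 1) \<longrightarrow>
            has_cfrac (sqrt (of_int (d_plus 1)))
              (periodic_quotients (a ^ k * b ^ l) [2 * h, 2 * a ^ k * b ^ l])) \<and>
         (d_minus 2 > 0 \<and> squarefree (d_minus 2) \<and> a * b \<ge> 3 \<longrightarrow>
            has_cfrac (sqrt (of_int (d_minus 2)))
              (periodic_quotients (a ^ k * b ^ l - 1) [1, h - 2, 1, 2 * a ^ k * b ^ l - 2])) \<and>
         (d_plus 2 > 0 \<and> squarefree (d_plus 2) \<longrightarrow>
            has_cfrac (sqrt (of_int (d_plus 2)))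
              (periodic_quotients (a ^ k * b ^ l) [h, 2 * a ^ k * b ^ l]))"
proof -
  define N where "N = a ^ k * b ^ l"
  have Npos: "N \<ge> 1" using assms(1,2) by (simp add: N_def int_one_le_iff_zero_less)
  have C: "c ^ m > 0" using assms(3) by simp
  have N: "N = h * c ^ m"
    using power_dvd_power_mult_power[OF assms(7-9)] assms(10) by (simp add: N_def)
  have h: "h \<ge> 1" using Npos C N by (smt (verit) mult_nonpos_nonneg)
  have Nsq: "a ^ (2 * k) * b ^ (2 * l) = N ^ 2"
    by (simp add: N_def power_mult_distrib mult.commute flip: power_mult)
  have ab: "a * b \<le> N"
    unfolding N_def using assms(1,2,4,5) by (intro mult_mono self_le_power) auto
  have quot: "real_of_int N / of_int h = of_int (c ^ m)"
    using h by (simp add: N)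
  \<comment> \<open>As \<open>N / h = c ^ m\<close>, the term \<open>2 * N / H\<close> is
    \<open>c ^ m\<close> for \<open>H = 2 * h\<close> and \<open>2 * c ^ m\<close> for
    \<open>H = h\<close>; \<open>e\<close> is the sign.\<close>
  have d1: "of_int (N ^ 2 + e * c ^ m) = (of_int N ^ 2 + of_int e * (2 * of_int N / of_int (2 * h)) :: real)"
    and d2: "of_int (N ^ 2 + e * 2 * c ^ m) = (of_int N ^ 2 + of_int e * (2 * of_int N / of_int h) :: real)" for e
    using quot by (simp_all flip: times_divide_eq_right)
  have "has_cfrac (sqrt (of_int (N ^ 2 - c ^ m)))
          (periodic_quotients (N - 1) [1, 2 * h - 2, 1, 2 * N - 2])"
    if "N ^ 2 - c ^ m > 0" "a * b \<ge> 2"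
  proof -
    have "2 * 2 \<le> 2 * h * N" using h ab that(2) by (intro mult_mono) auto
    have eq: "of_int (N ^ 2 - c ^ m) = (of_int N ^ 2 - 2 * of_int N / of_int (2 * h) :: real)"
      using d1[of "-1"] by simp
    have "(0::real) \<le> of_int (N ^ 2 - c ^ m)" using that(1) by (simp only: of_int_0_le_iff)
    then show ?thesis
      using \<open>2 * 2 \<le> 2 * h * N\<close> that(2) ab h unfolding eq
      by (intro has_cfrac_sqrt_minus; linarith)
  qed
  moreover have "has_cfrac (sqrt (of_int (N ^ 2 + c ^ m))) (periodic_quotients N [2 * h, 2 * N])"
    using has_cfrac_sqrt_plus[of N "2 * h"] d1[of 1] Npos h by simp
  moreover have "has_cfrac (sqrt (of_int (N ^ 2 - 2 * c ^ m)))
          (periodic_quotients (N - 1) [1, h - 2, 1, 2 * N - 2])"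
    if "N ^ 2 - 2 * c ^ m > 0" "a * b \<ge> 3"
  proof -
    \<comment> \<open>Here \<open>H = h\<close> may be 1, so the bound \<open>H * N \<ge> 3\<close>
      rests on \<open>N \<ge> a * b \<ge> 3\<close>.\<close>
    have "1 * 3 \<le> h * N" using h ab that(2) by (intro mult_mono) auto
    have eq: "of_int (N ^ 2 - 2 * c ^ m) = (of_int N ^ 2 - 2 * of_int N / of_int h :: real)"
      using d2[of "-1"] by simp
    have "(0::real) \<le> of_int (N ^ 2 - 2 * c ^ m)" using that(1) by (simp only: of_int_0_le_iff)
    then show ?thesis
      using \<open>1 * 3 \<le> h * N\<close> that(2) ab h unfolding eq
      by (intro has_cfrac_sqrt_minus; linarith)
  qed
  moreover have "has_cfrac (sqrt (of_int (N ^ 2 + 2 * c ^ m))) (periodic_quotients N [h, 2 * N])"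
    using has_cfrac_sqrt_plus[of N h] d2[of 1] Npos h by simp
  ultimately show ?thesis
    unfolding assms(11,12) Nsq mult.assoc N_def[symmetric] by simp
qed

end
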